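(* Let $0\le m\le n$ be integers with $n\ge 1$, and let $\lambda_0,\ldots,\lambda_m\in\mathbb{C}$ be such that all the zeros of $\phi(z)=\sum_{i=0}^m\binom{n}{i}\lambda_i z^i$ lie in the half plane $|z|\le |z-\frac n2|$. Let $N$ be the associated operator on $\mathcal{P}_n$. If $f$ is a polynomial of degree $n$ having all its zeros in $|z|\le 1$ and $P\in\mathcal{P}_n$ satisfies $$|P(z)|\le |f(z)|\quad\text{for } |z|=1,$$ then $$|N[P](z)|\le |N[f](z)|\quad\text{for } |z|\ge 1.$$ The result is sharp: equality holds for $P(z)=e^{i\alpha}f(z)$, $\alpha\in\mathbb{R}$.
   Context: $\mathcal{P}_n$ denotes the class of all polynomials with complex coefficients of degree at most $n$. For given $\lambda_0,\ldots,\lambda_m\in\mathbb{C}$ the operator $N:\mathcal{P}_n\to\mathcal{P}_n$ is defined by $$N[P](z)=\sum_{i=0}^{m}\lambda_i\left(\frac{nz}{2}\right)^i\frac{P^{(i)}(z)}{i!},$$ where $P^{(i)}$ is the $i$-th derivative of $P$. *)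

theory Defs
  imports Complex_Main "HOL-Computational_Algebra.Polynomial"
begin

definition poly_class :: "nat \<Rightarrow> complex poly set" where
  "poly_class n = {P. degree P \<le> n}"

definition N_op :: "nat \<Rightarrow> nat \<Rightarrow> (nat \<Rightarrow> complex) \<Rightarrow> complex poly \<Rightarrow> complex poly" where
  "N_op n m l P =
     (\<Sum>i\<le>m. smult (l i / fact i) ([:0, of_nat n / 2:] ^ i * (pderiv ^^ i) P))"

lemma poly_N_op:
  "poly (N_op n m l P) z =
     (\<Sum>i\<le>m. l i * (of_nat n * z / 2) ^ i * (poly ((pderiv ^^ i) P) z / fact i))"
  unfolding N_op_def poly_sum by (rule sum.cong) (simp_all add: mult_ac)

lemma N_op_in_poly_class:
  assumes "P \<in> poly_class n"
  shows "N_op n m l P \<in> poly_class n"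
proof -
  have "degree (smult (l i / fact i) ([:0, of_nat n / 2:] ^ i * (pderiv ^^ i) P)) \<le> n" for i
  proof (cases "i \<le> degree P")
    case True
    have "degree ([:0, of_nat n / 2::complex:] ^ i) \<le> i"
      by (rule order_trans[OF degree_power_le]) simp
    then have "degree ([:0, of_nat n / 2:] ^ i * (pderiv ^^ i) P) \<le> i + (degree P - i)"
      by (intro order_trans[OF degree_mult_le] add_mono) (simp_all add: degree_higher_pderiv)
    with True assms show ?thesis
      by (auto simp: poly_class_def intro: order_trans[OF degree_smult_le])
  next
    case False
    then have "(pderiv ^^ i) P = 0"
      by (intro poly_eqI) (simp add: coeff_higher_pderiv coeff_eq_0)
    then show ?thesis by simp
  qed
  then show ?thesis
    unfolding N_op_def poly_class_def by (auto intro: degree_sum_le)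
qed

end

theory Submission
  imports Defs "HOL-Complex_Analysis.Complex_Analysis"
begin

text \<open>
  The theorem is a comparison principle that follows from a zero-preservation property. Suppose that
  \<open>N_op\<close> maps polynomials of degree exactly \<open>n\<close> with all zeros in the closed unit disc to
  polynomials without zeros outside that disc (\<open>N_op_zeros\<close>). If \<open>N[P](x)\<close> were larger than
  \<open>N[f](x)\<close> in modulus at some point with \<open>|x| > 1\<close>, then \<open>c = N[P](x) / N[f](x)\<close>, whose
  denominator is not zero by that property of \<open>N_op\<close> applied to \<open>f\<close>, would satisfy \<open>|c| > 1\<close>, and
  \<open>P - c f\<close> would be sent to a polynomial vanishing at \<open>x\<close>. But \<open>P - c f\<close> has degree \<open>n\<close> and all
  its zeros in the closed disc: by the maximum principle \<open>|P| \<le> |f|\<close> persists from the unit circle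
  to its exterior and to the leading coefficients (\<open>dominated_outside_disc\<close>), so
  \<open>|P| < |c f|\<close> strictly outside. The circle \<open>|z| = 1\<close> itself is then reached by continuity.

  Zero preservation is an instance of Grace's apolarity theorem. For fixed \<open>z\<close> the number \<open>N[q](z)\<close> is
  linear in \<open>q\<close>, and equals, up to the factor \<open>n!\<close>, the apolar pairing of \<open>q\<close> with
  \<open>p(x) = (z - x)\<^sup>n \<phi>(n z / (2 (z - x)))\<close>, where \<open>\<phi>(w)\<close> is the sum of \<open>(n choose i) \<lambda>\<^sub>i w\<^sup>i\<close>
  (\<open>N_op_eq_apolar_pairing\<close>). If \<open>|x| \<le> 1 < |z|\<close>, the argument \<open>w\<close> of \<open>\<phi>\<close> satisfies
  \<open>|w - n/2| / |w| = |x| / |z| < 1\<close>, so that the hypothesis on \<open>\<phi>\<close> ensures that \<open>p\<close> has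
  no zero in the closed unit disc. Grace's theorem (\<open>grace_unit_disc\<close>) says that the pairing of such a
  \<open>p\<close> with a \<open>q\<close> whose zeros all lie in the disc does not vanish. It is proved by splitting off the zeros
  of \<open>q\<close> one at a time: a factor \<open>x - a\<close> of \<open>q\<close> can be traded for passing from \<open>p\<close> to its polar
  derivative with respect to \<open>a\<close>, which by Laguerre's theorem (\<open>laguerre_unit_disc\<close>) is again
  free of zeros in the disc.
\<close>

section \<open>Higher derivatives and linear factors\<close>

lemma higher_pderiv_eq_0:
  fixes p :: "'a :: idom poly"
  assumes "degree p < k"
  shows "(pderiv ^^ k) p = 0"
  using assms by (intro poly_eqI) (simp add: coeff_higher_pderiv coeff_eq_0)

text \<open>
  Leibniz' rule with a factor whose second derivative vanishes. At \<open>k = 0\<close> the last term is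
  killed by its coefficient.
\<close>

lemma higher_pderiv_linear_mult:
  "(pderiv ^^ k) ([:a, b:] * q) =
     [:a, b:] * (pderiv ^^ k) q + smult (of_nat k * b) ((pderiv ^^ (k - 1)) (q :: 'a :: idom poly))"
proof (induction k)
  case (Suc k)
  have "smult (of_nat k * b) (pderiv ((pderiv ^^ (k - 1)) q)) = smult (of_nat k * b) ((pderiv ^^ k) q)"
    by (cases k) simp_all
  then show ?case
    unfolding funpow.simps comp_def Suc
    by (simp add: pderiv_add pderiv_mult pderiv_smult pderiv_pCons smult_add_left algebra_simps)
qed simp

lemma poly_higher_pderiv_linear_power:
  "poly ((pderiv ^^ k) ([:z, -1:] ^ j)) z = (if j = k then (-1) ^ k * fact k else (0 :: 'a :: {idom, semiring_char_0}))"
proof (induction k arbitrary: j)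
  case (Suc k)
  show ?case
  proof (cases j)
    case (Suc i)
    have "pderiv ([:z, -1:] ^ Suc i) = smult (- of_nat (Suc i)) ([:z, -1:] ^ i)"
      by (subst pderiv_power_Suc) (simp add: pderiv_pCons)
    then show ?thesis
      using Suc.IH[of i] by (auto simp: Suc funpow_Suc_right higher_pderiv_smult ring_distribs simp del: power_Suc funpow.simps)
        (simp add: algebra_simps)
  next
    case 0
    then show ?thesis by (simp add: funpow_Suc_right higher_pderiv_0 del: funpow.simps)
  qed
qed (simp add: poly_power power_0_left)

lemma poly_linear_factor:
  fixes p :: "'a :: idom poly"
  assumes "poly p r = 0" "p \<noteq> 0"
  obtains q where "p = [:-r, 1:] * q" "degree p = Suc (degree q)" "q \<noteq> 0"
proof -
  from assms obtain q where q: "p = [:-r, 1:] * q"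
    by (auto simp: poly_eq_0_iff_dvd elim: dvdE)
  with assms(2) have "q \<noteq> 0" by auto
  with q show ?thesis by (intro that) (simp_all add: degree_mult_eq del: mult_pCons_left)
qed

lemma complex_poly_root_exists:
  fixes p :: "complex poly"
  assumes "degree p > 0"
  obtains r where "poly p r = 0"
proof (rule fundamental_theorem_of_algebra[of "coeff p" "degree p"])
  have "coeff p (degree p) \<noteq> 0" using assms by auto
  then show "coeff p 0 = 0 \<or> (\<exists>i\<in>{1..degree p}. coeff p i \<noteq> 0)"
    using assms by (intro disjI2 bexI[of _ "degree p"]) auto
qed (auto simp: poly_altdef that)

section \<open>Laguerre's theorem for the unit disc\<close>

text \<open>
  For nonzero \<open>s = 1 / (v - t)\<close> the condition reads \<open>|t| > 1\<close>, so this is the image of the exterior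
  of the unit disc, with the point at infinity, under \<open>t \<mapsto> 1 / (v - t)\<close>. As \<open>v\<close> lies in the disc,
  the image is an open disc or half plane. In coordinates the set is the positivity set of
  \<open>1 - 2 Re (v s) - (1 - |v|\<^sup>2) |s|\<^sup>2\<close>, which is a concave function of \<open>s\<close>.
\<close>

lemma convex_reciprocal_region:
  fixes v :: complex
  assumes "cmod v \<le> 1"
  shows "convex {s. cmod s < cmod (v * s - 1)}"
proof (rule convexI)
  let ?D = "1 - (cmod v)\<^sup>2"
  let ?h = "\<lambda>s. 1 - 2 * Re (v * s) - ?D * (cmod s)\<^sup>2"
  have h: "cmod s < cmod (v * s - 1) \<longleftrightarrow> 0 < ?h s" for s
  proof -
    have "cmod s < cmod (v * s - 1) \<longleftrightarrow> (cmod s)\<^sup>2 < (cmod (v * s - 1))\<^sup>2"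
      using power_strict_mono[of "cmod s" "cmod (v * s - 1)" 2]
        power2_less_imp_less[of "cmod s" "cmod (v * s - 1)"] by auto
    also have "(cmod (v * s - 1))\<^sup>2 = (cmod v)\<^sup>2 * (cmod s)\<^sup>2 - 2 * Re (v * s) + 1"
      unfolding cmod_power2 by (simp add: power2_eq_square algebra_simps)
    finally show ?thesis by (simp add: algebra_simps)
  qed
  have D: "?D \<ge> 0" using assms by (simp add: power_le_one)
  fix s t :: complex and a b :: real
  assume st: "s \<in> {s. cmod s < cmod (v * s - 1)}" "t \<in> {s. cmod s < cmod (v * s - 1)}"
    and ab: "0 \<le> a" "0 \<le> b" "a + b = 1"
  have b: "b = 1 - a" using ab by simp
  \<comment> \<open>the last term is the defect of concavity, from the parallelogram-type identity
    for \<open>|a s + b t|\<^sup>2\<close>\<close>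
  have "?h (a *\<^sub>R s + b *\<^sub>R t) = a * ?h s + b * ?h t + ?D * (a * b * (cmod (s - t))\<^sup>2)"
  proof -
    have "(cmod (a *\<^sub>R s + b *\<^sub>R t))\<^sup>2 =
        a * (cmod s)\<^sup>2 + b * (cmod t)\<^sup>2 - a * b * (cmod (s - t))\<^sup>2"
      unfolding cmod_power2 b by (simp add: power2_eq_square algebra_simps)
    moreover have "1 - 2 * Re (v * (a *\<^sub>R s + b *\<^sub>R t)) =
        a * (1 - 2 * Re (v * s)) + b * (1 - 2 * Re (v * t))"
      unfolding b by (simp add: algebra_simps)
    ultimately show ?thesis by algebra
  qed
  moreover have "a * ?h s + b * ?h t > 0"
  proof (cases "a = 0")
    case False
    then have "a * ?h s > 0" "b * ?h t \<ge> 0" using st ab h by (auto simp: less_imp_le)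
    then show ?thesis by linarith
  qed (use st ab h in auto)
  moreover have "?D * (a * b * (cmod (s - t))\<^sup>2) \<ge> 0" using D ab by auto
  ultimately have "?h (a *\<^sub>R s + b *\<^sub>R t) > 0" by linarith
  then show "a *\<^sub>R s + b *\<^sub>R t \<in> {s. cmod s < cmod (v * s - 1)}" using h by blast
qed

text \<open>
  The logarithmic derivative \<open>p' / p\<close> at \<open>v\<close> is the sum of the numbers \<open>1 / (v - r)\<close> over the zeros
  \<open>r\<close> of \<open>p\<close>, all of which lie in the convex region of the preceding lemma. If \<open>p\<close> has
  fewer than \<open>n\<close> zeros, the missing ones count as zeros at infinity and contribute
  \<open>0\<close>, which also lies in the region. The number \<open>s\<close> is the mean of these \<open>n\<close> points.
\<close>

lemma log_derivative_region:
  fixes p :: "complex poly"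
  assumes "degree p \<le> n" "\<And>x. cmod x \<le> 1 \<Longrightarrow> poly p x \<noteq> 0" "cmod v \<le> 1"
  shows "\<exists>s. cmod s < cmod (v * s - 1) \<and> poly (pderiv p) v = of_nat n * s * poly p v"
  using assms(1,2)
proof (induction n arbitrary: p)
  case 0
  then have "pderiv p = 0" by (simp add: pderiv_eq_0_iff)
  then show ?case by (intro exI[of _ 0]) simp
next
  case (Suc n)
  show ?case
  proof (cases "degree p = 0")
    case True
    then have "pderiv p = 0" by (simp add: pderiv_eq_0_iff)
    then show ?thesis by (intro exI[of _ 0]) simp
  next
    case False
    then have "degree p > 0" by simp
    then obtain r where r: "poly p r = 0" by (rule complex_poly_root_exists)
    have "p \<noteq> 0" using False by auto
    with r obtain q where q: "p = [:-r, 1:] * q" "degree p = Suc (degree q)"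
      by (rule poly_linear_factor)
    have "poly q x \<noteq> 0" if "cmod x \<le> 1" for x
      using Suc.prems(2)[OF that] q by auto
    with Suc.IH[of q] Suc.prems(1) q obtain s where
      s: "cmod s < cmod (v * s - 1)" "poly (pderiv q) v = of_nat n * s * poly q v" by auto
    have r1: "cmod r > 1" using Suc.prems(2)[of r] r by force
    with assms(3) have vr: "v - r \<noteq> 0" by auto
    define t where "t = 1 / (v - r)"
    have "v * t - 1 = r * t" using vr by (simp add: t_def field_simps)
    moreover have "cmod t > 0" using vr by (simp add: t_def)
    then have "cmod t < cmod (r * t)" using r1 by (simp add: norm_mult)
    ultimately have t: "cmod t < cmod (v * t - 1)" by simp
    \<comment> \<open>the mean over \<open>Suc n\<close> zeros as a convex combination of the new point and the mean over \<open>n\<close>\<close>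
    define w where "w = (1 / real (Suc n)) *\<^sub>R t + (real n / real (Suc n)) *\<^sub>R s"
    have "w \<in> {s. cmod s < cmod (v * s - 1)}"
      unfolding w_def
      by (rule convexD[OF convex_reciprocal_region[OF assms(3)]])
         (use s t in \<open>auto simp: field_simps\<close>)
    moreover have "of_nat (Suc n) * w = t + of_nat n * s"
    proof -
      have "(of_nat (Suc n) :: complex) \<noteq> 0" by (rule of_nat_neq_0)
      then show ?thesis unfolding w_def scaleR_conv_of_real
        by (simp add: field_simps del: of_nat_Suc)
    qed
    moreover have "poly (pderiv p) v = (t + of_nat n * s) * poly p v"
    proof -
      have "poly (pderiv p) v = (v - r) * (of_nat n * s * poly q v) + poly q v"
        unfolding q by (simp only: pderiv_mult poly_add poly_mult s) (simp add: pderiv_pCons)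
      also have "\<dots> = (t + of_nat n * s) * ((v - r) * poly q v)"
        using vr by (simp add: t_def field_simps)
      also have "(v - r) * poly q v = poly p v"
        unfolding q(1) by (simp add: algebra_simps)
      finally show ?thesis .
    qed
    ultimately show ?thesis by (intro exI[of _ w]) simp
  qed
qed

text \<open>
  With \<open>s\<close> as above, a zero \<open>v\<close> of the polar derivative with respect to \<open>a\<close> would give
  \<open>(v - a) s = 1\<close>, hence \<open>|v s - 1| = |a s| \<le> |s|\<close>.
\<close>

lemma laguerre_unit_disc:
  fixes p :: "complex poly"
  assumes "degree p \<le> n" "n > 0" "\<And>x. cmod x \<le> 1 \<Longrightarrow> poly p x \<noteq> 0" "cmod a \<le> 1" "cmod v \<le> 1"
  shows "poly (smult (of_nat n) p + [:a, -1:] * pderiv p) v \<noteq> 0"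
proof
  obtain s where s: "cmod s < cmod (v * s - 1)" "poly (pderiv p) v = of_nat n * s * poly p v"
    using log_derivative_region[OF assms(1,3,5)] by auto
  assume "poly (smult (of_nat n) p + [:a, -1:] * pderiv p) v = 0"
  then have "of_nat n * poly p v * (1 + (a - v) * s) = 0"
    using s by (simp add: algebra_simps)
  then have "1 + (a - v) * s = 0" using assms(2) assms(3)[OF assms(5)] by simp
  then have "v * s - 1 = a * s" by (simp add: algebra_simps)
  with s assms(4) show False
    by (simp add: norm_mult mult_left_le_one_le leD)
qed

section \<open>Grace's theorem for the unit disc\<close>

text \<open>
  For polynomials of degree at most \<open>n\<close> this is \<open>n!\<close> times the classical apolar invariant, whose
  usual expression in the coefficients arises at \<open>x = 0\<close>. The form with derivatives at an arbitrary
  base point \<open>x\<close> avoids binomial coefficients in the recursion and can be matched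
  with \<open>N_op\<close> at the point of evaluation.
\<close>

definition apolar_pairing :: "nat \<Rightarrow> 'a :: idom poly \<Rightarrow> 'a poly \<Rightarrow> 'a \<Rightarrow> 'a" where
  "apolar_pairing n p q x =
     (\<Sum>k\<le>n. (-1) ^ k * poly ((pderiv ^^ k) p) x * poly ((pderiv ^^ (n - k)) q) x)"

text \<open>
  The recursion behind Grace's theorem: expanding the derivatives of \<open>(x - a) q\<close> by
  Leibniz' rule and shifting the summation index in one of the two sums moves the factor to the
  other argument, where it appears as the polar derivative \<open>(n + 1) p + (a - x) p'\<close>.
\<close>

lemma apolar_pairing_linear_mult:
  fixes p q :: "'a :: idom poly"
  assumes "degree q \<le> n"
  shows "apolar_pairing (Suc n) p ([:-a, 1:] * q) x =
         apolar_pairing n (smult (of_nat (Suc n)) p + [:a, -1:] * pderiv p) q x"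
proof -
  define A where "A k = poly ((pderiv ^^ k) p) x" for k
  define B where "B k = poly ((pderiv ^^ k) q) x" for k
  have B0: "B (Suc n) = 0" using assms by (simp add: B_def higher_pderiv_eq_0 del: funpow.simps)
  have "poly ((pderiv ^^ k) ([:-a, 1:] * q)) x = (x - a) * B k + of_nat k * B (k - 1)" for k
    unfolding higher_pderiv_linear_mult by (simp add: B_def algebra_simps)
  then have "apolar_pairing (Suc n) p ([:-a, 1:] * q) x =
      (\<Sum>k\<le>Suc n. (-1) ^ k * A k * ((x - a) * B (Suc n - k) + of_nat (Suc n - k) * B (Suc n - k - 1)))"
    by (simp only: apolar_pairing_def A_def)
  also have "\<dots> = (\<Sum>k\<le>Suc n. (-1) ^ k * A k * (x - a) * B (Suc n - k)) +
      (\<Sum>k\<le>Suc n. (-1) ^ k * A k * of_nat (Suc n - k) * B (Suc n - k - 1))"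
    by (simp only: sum.distrib[symmetric] algebra_simps)
  also have "(\<Sum>k\<le>Suc n. (-1) ^ k * A k * (x - a) * B (Suc n - k)) =
      (\<Sum>k\<le>n. (-1) ^ k * ((a - x) * A (Suc k)) * B (n - k))"
    by (subst sum.atMost_Suc_shift) (simp add: B0 algebra_simps)
  also have "(\<Sum>k\<le>Suc n. (-1) ^ k * A k * of_nat (Suc n - k) * B (Suc n - k - 1)) =
      (\<Sum>k\<le>n. (-1) ^ k * (of_nat (Suc n - k) * A k) * B (n - k))"
    by (simp add: mult_ac diff_right_commute)
  also have "(\<Sum>k\<le>n. (-1) ^ k * ((a - x) * A (Suc k)) * B (n - k)) + \<dots> =
      (\<Sum>k\<le>n. (-1) ^ k * (of_nat (Suc n - k) * A k + (a - x) * A (Suc k)) * B (n - k))"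
    by (simp only: sum.distrib[symmetric] algebra_simps)
  also have "\<dots> = apolar_pairing n (smult (of_nat (Suc n)) p + [:a, -1:] * pderiv p) q x"
    unfolding apolar_pairing_def
  proof (rule sum.cong[OF refl])
    \<comment> \<open>differentiating \<open>a - x\<close> turns the coefficient \<open>Suc n\<close> of the \<open>k\<close>-th derivative into \<open>Suc n - k\<close>\<close>
    fix k assume "k \<in> {..n}"
    then have k: "(of_nat (Suc n - k) :: 'a) = of_nat (Suc n) - of_nat k"
      by (intro of_nat_diff) auto
    have "poly (smult (of_nat k * -1) ((pderiv ^^ (k - 1)) (pderiv p))) x = - of_nat k * A k"
      by (cases k) (simp_all add: A_def funpow_swap1)
    moreover have "poly ((pderiv ^^ k) (pderiv p)) x = A (Suc k)"
      by (simp add: A_def funpow_swap1)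
    ultimately have "poly ((pderiv ^^ k) (smult (of_nat (Suc n)) p + [:a, -1:] * pderiv p)) x =
        of_nat (Suc n - k) * A k + (a - x) * A (Suc k)"
      unfolding higher_pderiv_add higher_pderiv_smult higher_pderiv_linear_mult k
      by (simp only: poly_add poly_smult poly_mult) (simp add: A_def[symmetric] algebra_simps del: of_nat_Suc)
    then show "(-1) ^ k * (of_nat (Suc n - k) * A k + (a - x) * A (Suc k)) * B (n - k) =
       (-1) ^ k * poly ((pderiv ^^ k) (smult (of_nat (Suc n)) p + [:a, -1:] * pderiv p)) x *
       poly ((pderiv ^^ (n - k)) q) x"
      by (simp only: B_def)
  qed
  finally show ?thesis .
qed

text \<open>
  The coefficients of \<open>x ^ Suc n\<close> in \<open>Suc n * p\<close> and in \<open>x * p'\<close> coincide.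
\<close>

lemma degree_polar_derivative:
  fixes p :: "'a :: idom poly"
  assumes "degree p \<le> Suc n"
  shows "degree (smult (of_nat (Suc n)) p + [:a, -1:] * pderiv p) \<le> n"
proof (rule degree_le, intro allI impI)
  fix i assume "n < i"
  then obtain j where j: "i = Suc j" "n \<le> j" by (cases i) auto
  have "coeff p (Suc i) = 0" "j = n \<or> coeff p i = 0" using assms j by (auto intro!: coeff_eq_0)
  then show "coeff (smult (of_nat (Suc n)) p + [:a, -1:] * pderiv p) i = 0"
    by (auto simp: j coeff_pderiv algebra_simps)
qed

text \<open>
  As \<open>q\<close> has as many zeros as the formal degree \<open>n\<close> of \<open>p\<close>, each of them pays for one polar derivative
  of \<open>p\<close>, which stays free of zeros in the disc by Laguerre's theorem, until both polynomials are
  nonzero constants.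
\<close>

lemma grace_unit_disc:
  assumes "degree p \<le> n" "\<And>x. cmod x \<le> 1 \<Longrightarrow> poly p x \<noteq> 0"
    and "degree q = n" "q \<noteq> 0" "\<And>x. poly q x = 0 \<Longrightarrow> cmod x \<le> 1"
  shows "apolar_pairing n p q x \<noteq> 0"
  using assms
proof (induction n arbitrary: p q)
  case 0
  then obtain c d where "p = [:c:]" "q = [:d:]" by (metis degree_eq_zeroE le_0_eq)
  with 0 show ?case using "0.prems"(2)[of 0] by (auto simp: apolar_pairing_def)
next
  case (Suc n)
  then have "degree q > 0" by simp
  then obtain a where a: "poly q a = 0" by (rule complex_poly_root_exists)
  then obtain r where r: "q = [:-a, 1:] * r" "degree q = Suc (degree r)" "r \<noteq> 0"
    using \<open>q \<noteq> 0\<close> by (rule poly_linear_factor)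
  have "apolar_pairing n (smult (of_nat (Suc n)) p + [:a, -1:] * pderiv p) r x \<noteq> 0"
  proof (rule Suc.IH)
    show "degree (smult (of_nat (Suc n)) p + [:a, -1:] * pderiv p) \<le> n"
      by (rule degree_polar_derivative) fact
    show "poly (smult (of_nat (Suc n)) p + [:a, -1:] * pderiv p) v \<noteq> 0" if "cmod v \<le> 1" for v
      using Suc.prems a that by (intro laguerre_unit_disc) auto
    show "cmod x \<le> 1" if "poly r x = 0" for x
      using Suc.prems(5)[of x] that r by simp
  qed (use Suc.prems r in auto)
  then show ?case
    using apolar_pairing_linear_mult[of r n p a x] Suc.prems(3) r by simp
qed

section \<open>Zeros of the image polynomial\<close>

text \<open>
  Expanding the first polynomial in powers of \<open>z - x\<close> makes its derivatives at the base point \<open>z\<close>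
  single out one summand each: the derivative of order \<open>n - i\<close> carries the coefficient \<open>l i\<close>, and the
  pairing multiplies it with the \<open>i\<close>-th derivative of \<open>q\<close>.
\<close>

lemma N_op_eq_apolar_pairing:
  assumes "m \<le> n"
  shows "fact n * poly (N_op n m l q) z =
    apolar_pairing n (\<Sum>i\<le>m. smult (of_nat (n choose i) * l i * (of_nat n * z / 2) ^ i) ([:z, -1:] ^ (n - i))) q z"
    (is "_ = apolar_pairing n ?p q z")
proof -
  let ?b = "\<lambda>i. l i * (of_nat n * z / 2) ^ i"
  have A: "poly ((pderiv ^^ (n - i)) ?p) z = (if i \<le> m then of_nat (n choose i) * ?b i * ((-1) ^ (n - i) * fact (n - i)) else 0)"
    if "i \<le> n" for i
  proof -
    have "poly ((pderiv ^^ (n - i)) ?p) z =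
      (\<Sum>j\<le>m. if j = i then of_nat (n choose i) * ?b i * ((-1) ^ (n - i) * fact (n - i)) else 0)"
      unfolding higher_pderiv_sum poly_sum higher_pderiv_smult poly_smult poly_higher_pderiv_linear_power
      by (rule sum.cong[OF refl]) (use assms that in auto)
    then show ?thesis by (simp add: sum.delta)
  qed
  have cancel: "e * (c * b * (e * d)) = b * g" if "c * d = g" "e * e = 1" for b c d e g :: complex
  proof -
    have "e * (c * b * (e * d)) = b * (c * d) * (e * e)" by (simp only: mult_ac)
    then show ?thesis using that by simp
  qed
  have "apolar_pairing n ?p q z =
    (\<Sum>i\<le>n. (-1) ^ (n - i) * poly ((pderiv ^^ (n - i)) ?p) z * poly ((pderiv ^^ i) q) z)"
    unfolding apolar_pairing_def by (rule sum.reindex_bij_witness[of _ "\<lambda>i. n - i" "\<lambda>i. n - i"]) auto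
  also have "\<dots> = (\<Sum>i\<le>n. if i \<le> m then fact n * (?b i * (poly ((pderiv ^^ i) q) z / fact i)) else 0)"
  proof (rule sum.cong[OF refl])
    fix i assume "i \<in> {..n}"
    then have i: "i \<le> n" by simp
    have "(of_nat (n choose i) :: complex) * fact (n - i) = fact n / fact i"
      using binomial_fact[OF i, where 'a = complex] by simp
    moreover have "(-1 :: complex) ^ (n - i) * (-1) ^ (n - i) = 1"
      by (simp add: power_mult_distrib[symmetric])
    ultimately have "(-1) ^ (n - i) * (of_nat (n choose i) * ?b i * ((-1) ^ (n - i) * fact (n - i))) =
        ?b i * (fact n / fact i)"
      by (rule cancel)
    then show "(-1) ^ (n - i) * poly ((pderiv ^^ (n - i)) ?p) z * poly ((pderiv ^^ i) q) z =
      (if i \<le> m then fact n * (?b i * (poly ((pderiv ^^ i) q) z / fact i)) else 0)"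
      unfolding A[OF i] by simp
  qed
  also have "\<dots> = (\<Sum>i\<le>m. fact n * (?b i * (poly ((pderiv ^^ i) q) z / fact i)))"
    by (rule sum.mono_neutral_cong_right) (use assms in auto)
  also have "\<dots> = fact n * poly (N_op n m l q) z"
    by (simp add: poly_N_op sum_distrib_left)
  finally show ?thesis by simp
qed

text \<open>
  The hypothesis on \<open>\<phi>(w) = (\<Sum>i\<le>m. of_nat (n choose i) * l i * w ^ i)\<close> is what Grace's theorem needs:
  the polynomial paired with \<open>q\<close> is \<open>(z - x) ^ n\<close> times \<open>\<phi>(w)\<close>, where
  \<open>w = n z / (2 (z - x))\<close>. For \<open>|x| \<le> 1 < |z|\<close> this \<open>w\<close> is closer to \<open>n/2\<close> than to \<open>0\<close>, hence
  outside the half plane that contains the zeros of \<open>\<phi>\<close>.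
\<close>

lemma N_op_zeros:
  assumes "m \<le> n" "1 \<le> n"
    and "\<And>z::complex. (\<Sum>i\<le>m. of_nat (n choose i) * l i * z ^ i) = 0
            \<Longrightarrow> cmod z \<le> cmod (z - of_nat n / 2)"
    and "degree q = n" "\<And>x. poly q x = 0 \<Longrightarrow> cmod x \<le> 1" "cmod z > 1"
  shows "poly (N_op n m l q) z \<noteq> 0"
proof -
  define p where "p = (\<Sum>i\<le>m. smult (of_nat (n choose i) * l i * (of_nat n * z / 2) ^ i) ([:z, -1:] ^ (n - i)))"
  have "apolar_pairing n p q z \<noteq> 0"
  proof (rule grace_unit_disc)
    show "degree p \<le> n"
      unfolding p_def by (intro degree_sum_le)
        (auto intro!: order_trans[OF degree_smult_le] order_trans[OF degree_power_le])
    show "q \<noteq> 0" using assms(2,4) by auto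
    fix x :: complex assume x: "cmod x \<le> 1"
    with assms(6) have zx: "z - x \<noteq> 0" by auto
    define w where "w = of_nat n * z / 2 / (z - x)"
    have "poly p x = (\<Sum>i\<le>m. of_nat (n choose i) * l i * (of_nat n * z / 2) ^ i * (z - x) ^ (n - i))"
      by (simp add: p_def poly_sum poly_power)
    also have "\<dots> = (z - x) ^ n * (\<Sum>i\<le>m. of_nat (n choose i) * l i * w ^ i)"
      unfolding sum_distrib_left
    proof (rule sum.cong[OF refl])
      fix i assume "i \<in> {..m}"
      then have split: "(z - x) ^ n = (z - x) ^ i * (z - x) ^ (n - i)"
        using assms(1) by (simp flip: power_add)
      have "of_nat n * z / 2 = w * (z - x)"
        using zx unfolding w_def by (simp only: nonzero_divide_eq_eq[OF zx, symmetric])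
      then have num: "(of_nat n * z / 2) ^ i = w ^ i * (z - x) ^ i"
        by (simp only: power_mult_distrib)
      show "of_nat (n choose i) * l i * (of_nat n * z / 2) ^ i * (z - x) ^ (n - i) =
          (z - x) ^ n * (of_nat (n choose i) * l i * w ^ i)"
        unfolding split num by (simp only: mult_ac)
    qed
    finally have px: "poly p x = (z - x) ^ n * (\<Sum>i\<le>m. of_nat (n choose i) * l i * w ^ i)" .
    have "w - of_nat n / 2 = of_nat n * x / 2 / (z - x)"
      using zx by (simp add: w_def field_simps)
    moreover have "cmod (of_nat n * x / 2 / (z - x)) < cmod (of_nat n * z / 2 / (z - x))"
      unfolding norm_divide norm_mult using zx x assms(2,6)
      by (intro divide_strict_right_mono mult_strict_left_mono) auto
    ultimately have "cmod (w - of_nat n / 2) < cmod w" by (simp add: w_def)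
    with assms(3)[of w] zx show "poly p x \<noteq> 0" unfolding px by auto
  qed fact+
  then show ?thesis
    using N_op_eq_apolar_pairing[OF assms(1), of l q z] by (auto simp: p_def)
qed

section \<open>Comparison of polynomials outside the unit disc\<close>

lemma closure_unit_circle_minus_point:
  fixes r :: complex
  assumes "cmod r = 1"
  shows "r \<in> closure {z. cmod z = 1 \<and> z \<noteq> r}"
proof -
  let ?X = "\<lambda>k::nat. r * cis (1 / real (Suc k))"
  have "(\<lambda>k. 1 / real (Suc k)) \<longlonglongrightarrow> 0"
    using LIMSEQ_inverse_real_of_nat by (simp add: inverse_eq_divide)
  then have "?X \<longlonglongrightarrow> r * cis 0"
    by (intro tendsto_intros)
  moreover have "?X k \<in> {z. cmod z = 1 \<and> z \<noteq> r}" for k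
  proof -
    have "sin (1 / real (Suc k)) > 0"
    proof (rule sin_gt_zero)
      have "1 / real (Suc k) \<le> 1" by simp
      then show "1 / real (Suc k) < pi" using pi_gt3 by linarith
    qed simp
    then have "cis (1 / real (Suc k)) \<noteq> 1"
      by (auto simp: complex_eq_iff)
    then show ?thesis using assms by (auto simp: norm_mult)
  qed
  ultimately show ?thesis unfolding closure_sequential by (intro exI[of _ ?X]) simp
qed

text \<open>
  The maximum principle for \<open>P / f\<close> on the exterior of the disc, including the point at infinity, where
  the quotient takes the value \<open>coeff P n / coeff f n\<close>. The substitution \<open>w = 1 / z\<close> brings it to
  the unit disc: \<open>F\<close> and \<open>G\<close> are the reversals of \<open>f\<close> and \<open>P\<close>, both taken with respect to
  degree \<open>n\<close>.
\<close>

lemma dominated_outside_disc_zeros_inside: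
  fixes f P :: "complex poly"
  assumes "degree P \<le> degree f" "\<And>z. poly f z = 0 \<Longrightarrow> cmod z < 1"
    and "\<And>z. cmod z = 1 \<Longrightarrow> cmod (poly P z) \<le> cmod (poly f z)"
  shows "(\<forall>z. cmod z \<ge> 1 \<longrightarrow> cmod (poly P z) \<le> cmod (poly f z)) \<and>
         cmod (coeff P (degree f)) \<le> cmod (lead_coeff f)"
proof -
  define n where "n = degree f"
  define F where "F = reflect_poly f"
  define G where "G = monom 1 (n - degree P) * reflect_poly P"
  have f0: "f \<noteq> 0" using assms(2)[of 1] by auto
  have F: "poly F w = w ^ n * poly f (inverse w)" if "w \<noteq> 0" for w
    using that by (simp add: F_def n_def poly_reflect_poly_nz)
  have G: "poly G w = w ^ n * poly P (inverse w)" if "w \<noteq> 0" for w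
    using that assms(1)
    by (simp add: G_def n_def poly_reflect_poly_nz poly_monom mult.assoc[symmetric] power_add[symmetric])
  have G0: "poly G 0 = coeff P n"
    using assms(1) by (cases "degree P = n") (auto simp: G_def poly_monom n_def coeff_eq_0)
  have Fnz: "poly F w \<noteq> 0" if "cmod w \<le> 1" for w
  proof (cases "w = 0")
    case False
    then have "cmod (inverse w) \<ge> 1" using that by (simp add: norm_inverse one_le_inverse)
    then show ?thesis using False assms(2)[of "inverse w"] by (auto simp: F)
  qed (use f0 in \<open>simp add: F_def\<close>)
  have main: "cmod (poly G w) \<le> cmod (poly F w)" if "cmod w \<le> 1" for w
  proof -
    have "cmod (poly G w / poly F w) \<le> 1"
    proof (rule maximum_modulus_frontier[of "\<lambda>w. poly G w / poly F w" "cball 0 1"])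
      show "(\<lambda>w. poly G w / poly F w) holomorphic_on interior (cball 0 1)"
        by (intro holomorphic_intros) (use Fnz in auto)
      show "continuous_on (closure (cball 0 1)) (\<lambda>w. poly G w / poly F w)"
        by (intro continuous_intros) (use Fnz in auto)
      show "cmod (poly G u / poly F u) \<le> 1" if "u \<in> frontier (cball 0 1)" for u
      proof -
        have u: "cmod u = 1" using that by (simp add: frontier_cball)
        then have "u \<noteq> 0" by auto
        with u Fnz[of u] assms(3)[of "inverse u"] show ?thesis
          by (simp add: F G norm_mult norm_power norm_divide norm_inverse divide_le_eq_1)
      qed
    qed (use that in auto)
    then show ?thesis using Fnz[OF that] by (simp add: norm_divide)
  qed
  show ?thesis
  proof (intro conjI allI impI)
    fix z :: complex assume z: "cmod z \<ge> 1"
    then have "z \<noteq> 0" by auto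
    with z main[of "inverse z"] show "cmod (poly P z) \<le> cmod (poly f z)"
      by (simp add: F G norm_mult norm_power norm_inverse inverse_le_1_iff)
  next
    show "cmod (coeff P (degree f)) \<le> cmod (lead_coeff f)"
      using main[of 0] G0 by (simp add: F_def n_def)
  qed
qed

text \<open>
  A zero of \<open>f\<close> on the circle is also a zero of \<open>P\<close>, so a common factor \<open>z - r\<close> can be cancelled. The
  inequality survives at \<open>r\<close> itself by continuity along the circle. Repeating this leads to the case
  without zeros of \<open>f\<close> on the circle.
\<close>

lemma dominated_outside_disc:
  fixes f P :: "complex poly"
  assumes "f \<noteq> 0" "degree P \<le> degree f" "\<And>z. poly f z = 0 \<Longrightarrow> cmod z \<le> 1"
    and "\<And>z. cmod z = 1 \<Longrightarrow> cmod (poly P z) \<le> cmod (poly f z)"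
  shows "(\<forall>z. cmod z \<ge> 1 \<longrightarrow> cmod (poly P z) \<le> cmod (poly f z)) \<and>
         cmod (coeff P (degree f)) \<le> cmod (lead_coeff f)"
  using assms
proof (induction "degree f" arbitrary: f P)
  case 0
  have "cmod z < 1" if "poly f z = 0" for z
    using that 0 by (metis degree_eq_zeroE poly_pCons mult_zero_right poly_0 add.right_neutral pCons_0_0)
  with 0 show ?case by (intro dominated_outside_disc_zeros_inside) auto
next
  case (Suc n)
  show ?case
  proof (cases "\<exists>r. poly f r = 0 \<and> cmod r = 1")
    case False
    then have "cmod z < 1" if "poly f z = 0" for z using Suc.prems(3)[OF that] that by force
    with Suc.prems show ?thesis by (intro dominated_outside_disc_zeros_inside) auto
  next
    case True
    then obtain r where r: "poly f r = 0" "cmod r = 1" by blast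
    obtain g where g: "f = [:-r, 1:] * g" "degree f = Suc (degree g)" "g \<noteq> 0"
      using poly_linear_factor[OF r(1) \<open>f \<noteq> 0\<close>] .
    have "poly P r = 0" using Suc.prems(4)[OF r(2)] r(1) by simp
    then obtain Q where Q: "P = [:-r, 1:] * Q" by (auto simp: poly_eq_0_iff_dvd)
    have dQ: "degree Q \<le> degree g"
    proof (cases "Q = 0")
      case False
      then have "degree P = Suc (degree Q)" unfolding Q by (subst degree_mult_eq) auto
      then show ?thesis using Suc.prems(2) g by simp
    qed simp
    have off: "cmod (poly Q z) \<le> cmod (poly g z)" if "cmod z = 1" "z \<noteq> r" for z
    proof -
      have "cmod (z - r) * cmod (poly Q z) \<le> cmod (z - r) * cmod (poly g z)"
        using Suc.prems(4)[OF that(1)] by (simp add: Q g(1) norm_mult[symmetric] algebra_simps)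
      with that show ?thesis by simp
    qed
    have "cmod (poly Q r) \<le> cmod (poly g r)"
    proof -
      have "cmod (poly Q r) - cmod (poly g r) \<le> 0"
        by (rule continuous_le_on_closure[OF _ closure_unit_circle_minus_point[OF r(2)]])
           (use off in \<open>auto intro!: continuous_intros\<close>)
      then show ?thesis by simp
    qed
    with off have "cmod (poly Q z) \<le> cmod (poly g z)" if "cmod z = 1" for z
      using that by (cases "z = r") auto
    moreover have "cmod z \<le> 1" if "poly g z = 0" for z
      using Suc.prems(3)[of z] that g by simp
    ultimately have IH: "(\<forall>z. cmod z \<ge> 1 \<longrightarrow> cmod (poly Q z) \<le> cmod (poly g z)) \<and>
        cmod (coeff Q (degree g)) \<le> cmod (lead_coeff g)"
      using Suc.hyps(1)[of g Q] Suc.hyps(2) g dQ by simp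
    have "cmod (poly P z) \<le> cmod (poly f z)" if "cmod z \<ge> 1" for z
      using IH that unfolding Q g(1) poly_mult norm_mult by (intro mult_left_mono) auto
    moreover have "cmod (coeff P (degree f)) \<le> cmod (lead_coeff f)"
    proof -
      have "coeff P (degree f) = coeff Q (degree g)" "lead_coeff f = lead_coeff g"
        using dQ unfolding g(2) by (simp_all add: Q g(1) coeff_eq_0)
      with IH show ?thesis by simp
    qed
    ultimately show ?thesis by blast
  qed
qed

section \<open>The comparison theorem\<close>

lemma N_op_diff_smult:
  "poly (N_op n m l (P - smult c f)) z = poly (N_op n m l P) z - c * poly (N_op n m l f) z"
proof -
  have "(pderiv ^^ i) (P - smult c f) = (pderiv ^^ i) P - smult c ((pderiv ^^ i) f)" for i
    by (induction i) (simp_all add: pderiv_diff pderiv_smult)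
  then show ?thesis
    by (simp add: poly_N_op sum_distrib_left diff_divide_distrib right_diff_distrib sum_subtractf mult_ac)
qed

lemma N_op_smult: "poly (N_op n m l (smult c f)) z = c * poly (N_op n m l f) z"
  using N_op_diff_smult[of n m l 0 "-c" f z] by (simp add: poly_N_op[of _ _ _ 0])

text \<open>
  If the inequality failed at \<open>x\<close>, then \<open>P - c f\<close> with \<open>c = N[P](x) / N[f](x)\<close> would contradict
  \<open>N_op_zeros\<close>. Because \<open>|c| > 1\<close>, the weak domination of \<open>P\<close> by \<open>f\<close> is already enough to keep the
  zeros of \<open>P - c f\<close> in the closed disc and its degree equal to \<open>n\<close>.
\<close>

lemma N_op_comparison_outside:
  assumes "m \<le> n" "1 \<le> n"
    and "\<And>z::complex. (\<Sum>i\<le>m. of_nat (n choose i) * l i * z ^ i) = 0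
            \<Longrightarrow> cmod z \<le> cmod (z - of_nat n / 2)"
    and "degree f = n" "\<And>z. poly f z = 0 \<Longrightarrow> cmod z \<le> 1"
    and P: "degree P \<le> n" "\<And>z. cmod z = 1 \<Longrightarrow> cmod (poly P z) \<le> cmod (poly f z)"
    and x: "cmod x > 1"
  shows "cmod (poly (N_op n m l P) x) \<le> cmod (poly (N_op n m l f) x)"
proof (rule ccontr)
  assume "\<not> ?thesis"
  then have less: "cmod (poly (N_op n m l f) x) < cmod (poly (N_op n m l P) x)" by simp
  have f0: "f \<noteq> 0" using assms(2,4) by auto
  have dom: "(\<forall>z. cmod z \<ge> 1 \<longrightarrow> cmod (poly P z) \<le> cmod (poly f z)) \<and>
      cmod (coeff P (degree f)) \<le> cmod (lead_coeff f)"
    by (rule dominated_outside_disc[OF f0 _ assms(5) P(2)]) (use P(1) assms(4) in auto)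
  have Nf: "poly (N_op n m l f) x \<noteq> 0" by (rule N_op_zeros[OF assms(1-5) x])
  define c where "c = poly (N_op n m l P) x / poly (N_op n m l f) x"
  have c: "cmod c > 1" using less Nf by (simp add: c_def norm_divide)
  have "poly (N_op n m l (P - smult c f)) x \<noteq> 0"
  proof (rule N_op_zeros[OF assms(1-3) _ _ x])
    \<comment> \<open>the leading terms of \<open>P\<close> and \<open>c f\<close> cannot cancel, as \<open>|c| > 1\<close>\<close>
    have "cmod (lead_coeff f) < cmod (c * lead_coeff f)"
      using c f0 by (simp add: norm_mult)
    then have "coeff (P - smult c f) n \<noteq> 0" using dom assms(4) by auto
    moreover have "degree (P - smult c f) \<le> n"
      using P(1) assms(4) by (intro degree_diff_le) auto
    ultimately show "degree (P - smult c f) = n" by (intro antisym le_degree)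
    show "cmod w \<le> 1" if "poly (P - smult c f) w = 0" for w
    proof (rule ccontr)
      assume w: "\<not> cmod w \<le> 1"
      then have "poly f w \<noteq> 0" using assms(5) by blast
      then have "cmod (poly f w) < cmod (c * poly f w)" using c by (simp add: norm_mult)
      moreover have "cmod (poly P w) \<le> cmod (poly f w)" using dom w by simp
      ultimately show False using that by simp
    qed
  qed
  moreover have "poly (N_op n m l (P - smult c f)) x = 0"
    using Nf by (simp add: N_op_diff_smult c_def)
  ultimately show False by blast
qed

lemma poly_norm_le_closed_exterior:
  fixes p q :: "complex poly"
  assumes "\<And>x. cmod x > 1 \<Longrightarrow> cmod (poly p x) \<le> cmod (poly q x)" "cmod z \<ge> 1"
  shows "cmod (poly p z) \<le> cmod (poly q z)"
proof -
  have "z \<in> closure (- cball 0 1)"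
    using assms(2) by (simp add: closure_complement)
  then have "cmod (poly p z) - cmod (poly q z) \<le> 0"
    by (rule continuous_le_on_closure[rotated])
       (use assms(1) in \<open>auto intro!: continuous_intros\<close>)
  then show ?thesis by simp
qed

theorem theorem1p2:
  fixes m n :: nat and l :: "nat \<Rightarrow> complex" and f :: "complex poly"
  assumes "m \<le> n" and "1 \<le> n"
    and "\<And>z::complex. (\<Sum>i\<le>m. of_nat (n choose i) * l i * z ^ i) = 0
            \<Longrightarrow> cmod z \<le> cmod (z - of_nat n / 2)"
    and "degree f = n"
    and "\<And>z. poly f z = 0 \<Longrightarrow> cmod z \<le> 1"
  shows "(\<forall>P \<in> poly_class n.
            (\<forall>z. cmod z = 1 \<longrightarrow> cmod (poly P z) \<le> cmod (poly f z)) \<longrightarrow>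
            (\<forall>z. cmod z \<ge> 1 \<longrightarrow> cmod (poly (N_op n m l P) z) \<le> cmod (poly (N_op n m l f) z)))
       \<and> (\<forall>\<alpha>::real. \<forall>P. P = smult (exp (\<i> * complex_of_real \<alpha>)) f \<longrightarrow>
            P \<in> poly_class n \<and>
            (\<forall>z. cmod z = 1 \<longrightarrow> cmod (poly P z) \<le> cmod (poly f z)) \<and>
            (\<forall>z. cmod z \<ge> 1 \<longrightarrow> cmod (poly (N_op n m l P) z) = cmod (poly (N_op n m l f) z)))"
proof (intro conjI ballI allI impI)
  fix P z
  assume P: "P \<in> poly_class n" "\<forall>z. cmod z = 1 \<longrightarrow> cmod (poly P z) \<le> cmod (poly f z)"
    and z: "cmod z \<ge> 1"
  have "degree P \<le> n" using P(1) by (simp add: poly_class_def)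
  then have "cmod (poly (N_op n m l P) x) \<le> cmod (poly (N_op n m l f) x)" if "cmod x > 1" for x
    using P(2) that by (intro N_op_comparison_outside[OF assms]) auto
  then show "cmod (poly (N_op n m l P) z) \<le> cmod (poly (N_op n m l f) z)"
    using z by (rule poly_norm_le_closed_exterior)
qed (use assms(4) in \<open>auto simp: poly_class_def N_op_smult norm_mult\<close>)

end
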